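(* For any class $\mathcal{F}$ of graphs and every integer $k\geq 2$, $$\lambda_{\mathcal{F}}(k) \geq k^{D(\mathcal{F})},$$ where $k^{D(\mathcal{F})}$ is read as $\infty$ if $D(\mathcal{F})=\infty$.
   Context: All graphs are finite, have at least one vertex, and have no loops or multiple edges. A class of graphs is a nonempty set of graphs. For $k\in\mathbb{N}$, $[k]=\{1,\ldots,k\}$. A $k$-edge-colored graph is a pair $(G,c)$ where $G$ is a graph (the underlying graph) and $c:E(G)\to[k]$ is an arbitrary mapping (not required to be a proper edge coloring). A homomorphism of a $k$-edge-colored graph $(G_1,c_1)$ to a $k$-edge-colored graph $(G_2,c_2)$ is a mapping $h:V(G_1)\to V(G_2)$ such that for every two vertices $u,v$ adjacent in $G_1$, $h(u)$ and $h(v)$ are adjacent in $G_2$ and $c_1(\{u,v\})=c_2(\{h(u),h(v)\})$. A $k$-edge-colored graph $\mathbb{H}$ (finite, with underlying graph not necessarily in $\mathcal{F}$) is $k$-universal for $\mathcal{F}$ if every $k$-edge-colored graph whose underlying graph is in $\mathcal{F}$ admits a homomorphism to $\mathbb{H}$. $\lambda_{\mathcal{F}}(k)$ is the minimum number of vertices in a $k$-universal graph for $\mathcal{F}$, and $\lambda_{\mathcal{F}}(k)=\infty$ if no such graph exists. The density of a graph $G$ is $D(G)=\max\{|E(G')|/|V(G')| : G' \text{ is a nonempty subgraph of } G\}$, where nonempty means having at least one vertex, and the density of a class is $D(\mathcal{F})=\sup\{D(G): G\in\mathcal{F}\}$ (possibly $\infty$). *)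

theory Defs
  imports Complex_Main "HOL-Library.Extended_Real"
begin

record 'a pregraph =
  verts :: "'a set"
  edges :: "'a set set"

definition graph :: "'a pregraph \<Rightarrow> bool" where
  "graph G \<longleftrightarrow> finite (verts G) \<and> verts G \<noteq> {} \<and>
     (\<forall>e\<in>edges G. e \<subseteq> verts G \<and> card e = 2)"

definition graph_class :: "'a pregraph set \<Rightarrow> bool" where
  "graph_class \<F> \<longleftrightarrow> \<F> \<noteq> {} \<and> (\<forall>G\<in>\<F>. graph G)"

definition adjacent :: "'a pregraph \<Rightarrow> 'a \<Rightarrow> 'a \<Rightarrow> bool" where
  "adjacent G u v \<longleftrightarrow> {u, v} \<in> edges G"

definition subgraph :: "'a pregraph \<Rightarrow> 'a pregraph \<Rightarrow> bool" where
  "subgraph G' G \<longleftrightarrow> graph G' \<and> verts G' \<subseteq> verts G \<and> edges G' \<subseteq> edges G"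

text \<open>The values of a coloring outside the edge set are irrelevant.\<close>

type_synonym 'a colored_pregraph = "'a pregraph \<times> ('a set \<Rightarrow> nat)"

definition edge_colored_graph :: "nat \<Rightarrow> 'a colored_pregraph \<Rightarrow> bool" where
  "edge_colored_graph k = (\<lambda>(G, c). graph G \<and> (\<forall>e\<in>edges G. c e \<in> {1..k}))"

definition homomorphism ::
  "'a colored_pregraph \<Rightarrow> 'b colored_pregraph \<Rightarrow> ('a \<Rightarrow> 'b) \<Rightarrow> bool" where
  "homomorphism = (\<lambda>(G1, c1) (G2, c2) h.
     h ` verts G1 \<subseteq> verts G2 \<and>
     (\<forall>u\<in>verts G1. \<forall>v\<in>verts G1. adjacent G1 u v \<longrightarrow>
        adjacent G2 (h u) (h v) \<and> c1 {u, v} = c2 {h u, h v}))"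

definition universal :: "nat \<Rightarrow> 'a pregraph set \<Rightarrow> 'b colored_pregraph \<Rightarrow> bool" where
  "universal k \<F> H \<longleftrightarrow> edge_colored_graph k H \<and>
     (\<forall>G\<in>\<F>. \<forall>c. edge_colored_graph k (G, c) \<longrightarrow> (\<exists>h. homomorphism (G, c) H h))"

text \<open>
  Every finite graph has an isomorphic copy on natural numbers, so the universal graphs are
  taken with vertices of type \<^typ>\<open>nat\<close>. In \<^typ>\<open>enat\<close> the infimum of a nonempty set is its
  minimum, and the infimum of the empty set is \<open>\<infinity>\<close>.
\<close>

definition min_universal :: "'a pregraph set \<Rightarrow> nat \<Rightarrow> enat" where
  "min_universal \<F> k =
     Inf {enat (card (verts (fst H))) | H :: nat colored_pregraph. universal k \<F> H}"

definition density :: "'a pregraph \<Rightarrow> real" where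
  "density G =
     Max {real (card (edges G')) / real (card (verts G')) | G'. subgraph G' G}"

definition class_density :: "'a pregraph set \<Rightarrow> ereal" where
  "class_density \<F> = (SUP G\<in>\<F>. ereal (density G))"

text \<open>Only used for exponents \<open>d \<ge> 0\<close>; the value at \<open>-\<infinity>\<close> is immaterial.\<close>

definition nat_powr :: "nat \<Rightarrow> ereal \<Rightarrow> ereal" where
  "nat_powr k d = (if d = \<infinity> then \<infinity> else ereal (real k powr real_of_ereal d))"

end

theory Submission
  imports Defs "HOL-Library.FuncSet"
begin

text \<open>
  The bound is a counting argument. Let \<open>H\<close> be universal with \<open>n\<close> vertices, and let \<open>G'\<close> be a
  subgraph, with \<open>v\<close> vertices and \<open>m\<close> edges, of a graph \<open>G\<close> of the class. Each of the \<open>k\<^sup>m\<close>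
  colorings of the edges of \<open>G'\<close> extends to \<open>G\<close>, so it is induced by a homomorphism to \<open>H\<close>, and on
  \<open>G'\<close> it can be recovered from the restriction of that homomorphism to the \<open>v\<close> vertices of \<open>G'\<close>.
  There are only \<open>n\<^sup>v\<close> such restrictions, so \<open>k\<^sup>m \<le> n\<^sup>v\<close> (\<open>colorings_le_vertex_maps\<close>), that is,
  \<open>m / v \<le> log k n\<close>.

  Choosing \<open>G'\<close> to attain the density of \<open>G\<close>, one finds that \<open>log k n\<close> bounds the density of every
  graph in the class. Hence the density of the class is finite as soon as some universal graph
  exists, and \<open>k\<close> raised to it is at most \<open>n\<close>.
\<close>

lemma graph_finite_edges:
  assumes "graph G"
  shows "finite (edges G)"
proof (rule finite_subset)
  show "edges G \<subseteq> Pow (verts G)" using assms by (auto simp: graph_def)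
  show "finite (Pow (verts G))" using assms by (auto simp: graph_def)
qed

lemma graph_card_verts_pos: "graph G \<Longrightarrow> card (verts G) > 0"
  by (auto simp: graph_def card_gt_0_iff)

lemma subgraph_attaining_density:
  assumes "graph G"
  obtains G' where "subgraph G' G"
    and "density G = real (card (edges G')) / real (card (verts G'))"
proof -
  let ?A = "{real (card (edges G')) / real (card (verts G')) | G'. subgraph G' G}"
  have "?A \<subseteq> (\<lambda>(S, T). real (card T) / real (card S)) ` (Pow (verts G) \<times> Pow (edges G))"
    by (auto simp: subgraph_def image_iff Bex_def)
  moreover have "finite (Pow (verts G) \<times> Pow (edges G))"
    using assms graph_finite_edges[OF assms] by (simp add: graph_def)
  ultimately have "finite ?A"
    by (meson finite_imageI finite_subset)
  moreover have "subgraph G G" using assms by (simp add: subgraph_def)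
  then have "?A \<noteq> {}" by blast
  ultimately have "density G \<in> ?A"
    unfolding density_def by (rule Max_in)
  then show thesis using that by blast
qed

text \<open>
  A homomorphism to \<open>(H, d)\<close> induces the coloring \<open>e \<mapsto> d (h ` e)\<close>, which depends only on the values
  of \<open>h\<close> at the endpoints. Universality says that all colorings of the subgraph arise in this way,
  so the maps between the vertex sets are at least as numerous as the colorings.
\<close>

lemma colorings_le_vertex_maps:
  assumes univ: "universal k \<F> (H, d)" and G: "G \<in> \<F>" "graph G"
    and sub: "subgraph G' G" and k: "k \<ge> 1"
  shows "k ^ card (edges G') \<le> card (verts H) ^ card (verts G')"
proof -
  let ?C = "edges G' \<rightarrow>\<^sub>E {1..k}"
  let ?M = "verts G' \<rightarrow>\<^sub>E verts H"
  let ?induced = "\<lambda>h. \<lambda>e\<in>edges G'. d (h ` e)"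
  have G': "graph G'" and VG': "verts G' \<subseteq> verts G" and EG': "edges G' \<subseteq> edges G"
    using sub by (auto simp: subgraph_def)
  have finV: "finite (verts G')" using G' by (simp add: graph_def)
  have finH: "finite (verts H)"
    using univ by (auto simp: universal_def edge_colored_graph_def graph_def)
  have "?C \<subseteq> ?induced ` ?M"
  proof
    fix c assume c: "c \<in> ?C"
    \<comment> \<open>The color of the edges outside the subgraph is arbitrary; 1 is always available.\<close>
    define c' where "c' = (\<lambda>e. if e \<in> edges G' then c e else 1)"
    have "edge_colored_graph k (G, c')"
      using c k G(2) by (auto simp: edge_colored_graph_def c'_def PiE_iff)
    then obtain h where h: "homomorphism (G, c') (H, d) h"
      using univ G(1) unfolding universal_def by blast
    have "restrict h (verts G') \<in> ?M"
      using h VG' by (auto simp: homomorphism_def)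
    moreover have "c = ?induced (restrict h (verts G'))"
    proof
      fix e
      show "c e = ?induced (restrict h (verts G')) e"
      proof (cases "e \<in> edges G'")
        case True
        then have "card e = 2" and "e \<subseteq> verts G'"
          using G' by (auto simp: graph_def)
        then obtain u v where e: "e = {u, v}" and uv: "u \<in> verts G'" "v \<in> verts G'"
          by (auto simp: card_2_iff)
        have "adjacent G u v" using True EG' e by (auto simp: adjacent_def)
        then have "c' {u, v} = d {h u, h v}"
          using h uv VG' by (auto simp: homomorphism_def)
        then show ?thesis using True e uv by (simp add: c'_def)
      next
        case False
        then show ?thesis by (simp add: PiE_arb[OF c])
      qed
    qed
    ultimately show "c \<in> ?induced ` ?M" by (intro image_eqI)
  qed
  moreover have "finite ?M" using finV finH by (simp add: finite_PiE)
  ultimately have "card ?C \<le> card ?M" by (rule surj_card_le[rotated])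
  then show ?thesis using finV graph_finite_edges[OF G'] by (simp add: card_PiE)
qed

lemma density_le_log_card_universal:
  assumes univ: "universal k \<F> (H, d)" and G: "G \<in> \<F>" "graph G" and k: "k \<ge> 2"
  shows "density G \<le> log k (card (verts H))"
proof -
  obtain G' where sub: "subgraph G' G"
    and dens: "density G = real (card (edges G')) / real (card (verts G'))"
    using subgraph_attaining_density[OF G(2)] .
  let ?n = "card (verts H)" and ?m = "card (edges G')" and ?v = "card (verts G')"
  have n: "?n > 0"
    using univ by (auto simp: universal_def edge_colored_graph_def intro: graph_card_verts_pos)
  have v: "?v > 0" using sub by (auto simp: subgraph_def intro: graph_card_verts_pos)
  have "k ^ ?m \<le> ?n ^ ?v"
    using colorings_le_vertex_maps[OF univ G sub] k by simp
  then have "real k ^ ?m \<le> real ?n ^ ?v"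
    by (metis of_nat_le_iff of_nat_power)
  then have "log k (real k ^ ?m) \<le> log k (real ?n ^ ?v)"
    using k n by (subst log_le_cancel_iff) auto
  then have "real ?m \<le> real ?v * log k ?n"
    using k n by (simp add: log_nat_power)
  then show ?thesis using v by (simp add: dens divide_le_eq mult.commute)
qed

lemma nat_powr_class_density_le_card_universal:
  assumes cls: "graph_class \<F>" and univ: "universal k \<F> (H, d)" and k: "k \<ge> 2"
  shows "nat_powr k (class_density \<F>) \<le> ereal (card (verts H))"
proof -
  have n: "card (verts H) > 0"
    using univ by (auto simp: universal_def edge_colored_graph_def intro: graph_card_verts_pos)
  have le: "class_density \<F> \<le> ereal (log k (card (verts H)))"
    unfolding class_density_def
    using cls density_le_log_card_universal[OF univ _ _ k]
    by (intro SUP_least) (auto simp: graph_class_def)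
  obtain G where "G \<in> \<F>" using cls by (auto simp: graph_class_def)
  then have "ereal (density G) \<le> class_density \<F>"
    unfolding class_density_def by (rule SUP_upper)
  with le obtain r where r: "class_density \<F> = ereal r"
    by (cases "class_density \<F>") auto
  have "real k powr r \<le> real k powr log k (card (verts H))"
    using le r k by (intro powr_mono) auto
  also have "\<dots> = card (verts H)" using k n by simp
  finally show ?thesis by (simp add: nat_powr_def r)
qed

lemma Inf_enat_in:
  fixes S :: "enat set"
  assumes "S \<noteq> {}"
  shows "Inf S \<in> S"
proof -
  obtain x where "x \<in> S" using assms by blast
  then have "(LEAST y. y \<in> S) \<in> S" by (rule LeastI)
  then show ?thesis using assms by (simp add: Inf_enat_def)
qed

theorem theorem7:
  fixes \<F> :: "'a pregraph set" and k :: nat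
  assumes "graph_class \<F>" and "k \<ge> 2"
  shows "ereal_of_enat (min_universal \<F> k) \<ge> nat_powr k (class_density \<F>)"
proof -
  let ?S = "{enat (card (verts (fst H))) | H :: nat colored_pregraph. universal k \<F> H}"
  show ?thesis
  proof (cases "?S = {}")
    case True
    have "min_universal \<F> k = \<infinity>"
      unfolding min_universal_def True by (simp add: Inf_enat_def)
    then show ?thesis by simp
  next
    case False
    then have "min_universal \<F> k \<in> ?S"
      unfolding min_universal_def by (rule Inf_enat_in)
    then obtain H :: "nat colored_pregraph"
      where "universal k \<F> H" and "min_universal \<F> k = enat (card (verts (fst H)))"
      by blast
    then show ?thesis
      using nat_powr_class_density_le_card_universal[of \<F> k "fst H" "snd H"] assms by simp
  qed
qed

end
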